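(* Consider a stochastic generalized unsplittable flow problem on a network $G=(V,A)$ with $\bar V=\{q\}$, and let $\mathcal D$ be a decision diagram constructed by the exact construction procedure (described in the context) for the node $q$ and parameter $\Gamma$. Then $\operatorname{Sol}(\mathcal D)$ represents the feasible region $\mathcal F$ of the master problem, where $\mathcal F$ is the set of all $(\boldsymbol w^q;z)$ with $\boldsymbol w^q=(w^q_1,\dots,w^q_{|\delta^-(q)|})$ satisfying $$\sum_{i\in\delta^-(q)}\operatorname{sign}\left(\left|w^q_{\operatorname{ind}^-(i,q)}-\operatorname{ind}^+(q,j)\right|\right)\ge|\delta^-(q)|-1\qquad\forall j\in\delta^+(q),$$ $$w^q_{\operatorname{ind}^-(i,q)}\in\{0,1,\dots,|\delta^+(q)|\}\qquad\forall i\in\delta^-(q),\qquad z\in[-\Gamma,\Gamma].$$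
   Context: Network. $G=(V,A)$ is a finite directed graph with $V=V'\cup\{s,t\}$ (source $s$, sink $t$), and $\bar V\subseteq V'$ is the set of nodes subject to the no-split no-merge requirement (each incoming arc is matched with at most one outgoing arc and vice versa). $\delta^-(q)=\{i:(i,q)\in A\}$, $\delta^+(q)=\{j:(q,j)\in A\}$. $\operatorname{ind}^-(i,q)$ is a one-to-one mapping from the incoming arcs $(i,q)$ onto $\{1,\dots,|\delta^-(q)|\}$ and $\operatorname{ind}^+(q,j)$ is a one-to-one mapping from the outgoing arcs $(q,j)$ onto $\{1,\dots,|\delta^+(q)|\}$. $\operatorname{sign}$ returns $1$, $0$, $-1$ for positive, zero, negative arguments. The master problem of the stochastic generalized unsplittable flow problem is $\max\{z:(\boldsymbol w;z)\in\mathcal F\}$, where $z$ stands for the (expected) second-stage objective value and $-\Gamma,\Gamma$ (with $\Gamma\ge0$) are given valid lower and upper bounds on $z$. Decision diagrams. A decision diagram $\mathcal D=(\mathcal U,\mathcal A,l)$ with $N$ arc layers is a directed acyclic (multi)graph with node layers $\mathcal U_1,\dots,\mathcal U_{N+1}$, where $\mathcal U_1=\{r\}$ (root) and $\mathcal U_{N+1}=\{t\}$ (terminal of the diagram), arc layers $\mathcal A_1,\dots,\mathcal A_N$, each arc of $\mathcal A_j$ going from a node of $\mathcal U_j$ to a node of $\mathcal U_{j+1}$, and arc labels $l:\mathcal A\to\mathbb R$. An $r$-$t$ path $(a_1,\dots,a_N)$ encodes the point $(l(a_1),\dots,l(a_N))$. $\operatorname{Sol}(\mathcal D)$ is the finite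 collection of all $r$-$t$ paths, identified with the points they encode. Exact construction. Here $N=|\delta^-(q)|+1$; layer $h\le|\delta^-(q)|$ gives the value of $w^q_h$ and the last layer gives the value of $z$. Each node $u$ carries a state $s_u$. (1) Create the root $r\in\mathcal U_1$ with state $s_r=\{0,1,\dots,|\delta^+(q)|\}$. (2) For each $i=1,2,\dots,|\delta^-(q)|$ in turn, each $u\in\mathcal U_i$, and each $\ell\in s_u$: create a node $v\in\mathcal U_{i+1}$ with state $(s_u\setminus\{\ell\})\cup\{0\}$ and an arc in $\mathcal A_i$ from $u$ to $v$ with label $\ell$. (3) For each $u\in\mathcal U_{1+|\delta^-(q)|}$: create two arcs $a_1,a_2\in\mathcal A_{1+|\delta^-(q)|}$ from $u$ to the terminal node with labels $l(a_1)=\Gamma$ and $l(a_2)=-\Gamma$. Representation. A finite set $S$ of points represents $\mathcal F$ (with respect to the continuous coordinate $z$) if $S$ is a subset of $\mathcal F$ that contains all extreme points of $\mathcal F$ (points of $\mathcal F$ that are extreme in its convex hull), and $\max\{f(\boldsymbol w,z):(\boldsymbol w,z)\in\mathcal F\}=\max\{f(\boldsymbol w,z):(\boldsymbol w,z)\in S\}$ for every real-valued function $f$ that is convex in $z$ (for each fixed $\boldsymbol w$). *)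

theory Defs
  imports "HOL-Analysis.Analysis" "HOL-Analysis.Finite_Function_Topology" "Graph_Theory.Graph_Theory"
begin

section \<open>Networks\<close>

definition in_nbrs :: "'v pair_pre_digraph \<Rightarrow> 'v \<Rightarrow> 'v set" where
  "in_nbrs G q = {i. (i, q) \<in> parcs G}"

definition out_nbrs :: "'v pair_pre_digraph \<Rightarrow> 'v \<Rightarrow> 'v set" where
  "out_nbrs G q = {j. (q, j) \<in> parcs G}"

text \<open>\<open>V'\<close> is the node set without source \<open>s\<close> and sink \<open>t\<close>, and \<open>Vbar\<close> is the set of nodes subject
  to the no-split no-merge requirement.\<close>

locale gufp_network = pair_fin_digraph G
  for G :: "'v pair_pre_digraph" +
  fixes V' :: "'v set" and s t :: 'v and Vbar :: "'v set"
    and ind_in ind_out :: "'v \<Rightarrow> 'v \<Rightarrow> nat"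
  assumes verts_eq: "pverts G = V' \<union> {s, t}"
    and Vbar_subset: "Vbar \<subseteq> V'"
    and ind_in_bij: "\<And>v. v \<in> Vbar \<Longrightarrow>
      bij_betw (\<lambda>i. ind_in i v) (in_nbrs G v) {1..card (in_nbrs G v)}"
    and ind_out_bij: "\<And>v. v \<in> Vbar \<Longrightarrow>
      bij_betw (\<lambda>j. ind_out v j) (out_nbrs G v) {1..card (out_nbrs G v)}"

text \<open>Since \<open>n = card (in_nbrs G q)\<close> is not a type-level constant (and may be 0), a vector
  \<open>(w\<^sub>1, \<dots>, w\<^sub>n)\<close> is a finitely supported function on \<open>nat\<close> whose support lies in \<open>{1..n}\<close>. These
  functions form a real vector space, so that convex hulls and extreme points are the
  library ones.\<close>

type_synonym point = "(nat, real) poly_mapping \<times> real"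

definition master_region ::
  "'v pair_pre_digraph \<Rightarrow> ('v \<Rightarrow> 'v \<Rightarrow> nat) \<Rightarrow> ('v \<Rightarrow> 'v \<Rightarrow> nat) \<Rightarrow> 'v \<Rightarrow> real \<Rightarrow> point set" where
  "master_region G ind_in ind_out q \<Gamma> = {(w, z).
     Poly_Mapping.keys w \<subseteq> {1..card (in_nbrs G q)} \<and>
     (\<forall>j\<in>out_nbrs G q.
        (\<Sum>i\<in>in_nbrs G q. sgn \<bar>Poly_Mapping.lookup w (ind_in i q) - real (ind_out q j)\<bar>)
          \<ge> real (card (in_nbrs G q)) - 1) \<and>
     (\<forall>i\<in>in_nbrs G q. Poly_Mapping.lookup w (ind_in i q) \<in> real ` {0..card (out_nbrs G q)}) \<and>
     z \<in> {-\<Gamma>..\<Gamma>}}"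

section \<open>Decision diagrams\<close>

record ('u, 'e) diagram =
  dgraph :: "('u, 'e) pre_digraph"
  node_layer :: "nat \<Rightarrow> 'u set"
  arc_layer :: "nat \<Rightarrow> 'e set"
  root_node :: 'u
  terminal_node :: 'u
  arc_label :: "'e \<Rightarrow> real"

text \<open>Acyclicity is a consequence of the layering.\<close>

definition decision_diagram :: "nat \<Rightarrow> ('u, 'e) diagram \<Rightarrow> bool" where
  "decision_diagram N D \<longleftrightarrow>
     fin_digraph (dgraph D) \<and>
     verts (dgraph D) = (\<Union>j\<in>{1..N + 1}. node_layer D j) \<and>
     disjoint_family_on (node_layer D) {1..N + 1} \<and>
     arcs (dgraph D) = (\<Union>j\<in>{1..N}. arc_layer D j) \<and>
     disjoint_family_on (arc_layer D) {1..N} \<and>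
     node_layer D 1 = {root_node D} \<and>
     node_layer D (N + 1) = {terminal_node D} \<and>
     (\<forall>j\<in>{1..N}. \<forall>a\<in>arc_layer D j.
        tail (dgraph D) a \<in> node_layer D j \<and> head (dgraph D) a \<in> node_layer D (j + 1))"

text \<open>The last layer carries the continuous coordinate. The leading 0 shifts the list so that
  the label in layer \<open>h\<close> becomes the coordinate with index \<open>h\<close>.\<close>

definition point_of_labels :: "real list \<Rightarrow> point" where
  "point_of_labels ls = (Poly_Mapping.nth (0 # butlast ls), last ls)"

definition Sol :: "('u, 'e) diagram \<Rightarrow> point set" where
  "Sol D = (\<lambda>p. point_of_labels (map (arc_label D) p)) `
     {p. pre_digraph.apath (dgraph D) (root_node D) p (terminal_node D)}"

text \<open>\<open>st u\<close> is the state of the node \<open>u\<close>; \<open>v (u, l)\<close> and \<open>e (u, l)\<close> are the node and the arc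
  created for \<open>u\<close> and \<open>l \<in> st u\<close>. The bijections express that each creation yields a new object
  and that the layers contain nothing else. For \<open>\<Gamma> = 0\<close> the two arcs from each \<open>u\<close> to the
  terminal are parallel arcs with equal labels.\<close>

definition exact_construction ::
  "'v pair_pre_digraph \<Rightarrow> 'v \<Rightarrow> real \<Rightarrow> ('u, 'e) diagram \<Rightarrow> bool" where
  "exact_construction G q \<Gamma> D \<longleftrightarrow>
     (let n = card (in_nbrs G q); m = card (out_nbrs G q) in
      decision_diagram (n + 1) D \<and>
      (\<exists>st :: 'u \<Rightarrow> nat set.
        st (root_node D) = {0..m} \<and>
        (\<forall>i\<in>{1..n}. \<exists>v e.
          bij_betw v (SIGMA u:node_layer D i. st u) (node_layer D (i + 1)) \<and>
          bij_betw e (SIGMA u:node_layer D i. st u) (arc_layer D i) \<and>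
          (\<forall>u\<in>node_layer D i. \<forall>l\<in>st u.
             st (v (u, l)) = (st u - {l}) \<union> {0} \<and>
             tail (dgraph D) (e (u, l)) = u \<and>
             head (dgraph D) (e (u, l)) = v (u, l) \<and>
             arc_label D (e (u, l)) = real l)) \<and>
        (\<exists>a\<^sub>1 a\<^sub>2.
          arc_layer D (n + 1) = a\<^sub>1 ` node_layer D (n + 1) \<union> a\<^sub>2 ` node_layer D (n + 1) \<and>
          (\<forall>u\<in>node_layer D (n + 1).
             a\<^sub>1 u \<noteq> a\<^sub>2 u \<and>
             tail (dgraph D) (a\<^sub>1 u) = u \<and> tail (dgraph D) (a\<^sub>2 u) = u \<and>
             head (dgraph D) (a\<^sub>1 u) = terminal_node D \<and> head (dgraph D) (a\<^sub>2 u) = terminal_node D \<and>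
             arc_label D (a\<^sub>1 u) = \<Gamma> \<and> arc_label D (a\<^sub>2 u) = -\<Gamma>))))"

section \<open>Representation\<close>

text \<open>Both maxima are required to exist. Convexity of \<open>f (w, \<cdot>)\<close> is only required on the convex
  hull of the slice of \<open>F\<close> at \<open>w\<close>, so that \<open>f\<close> need not be convex (or meaningful) outside.\<close>

definition represents :: "('a::real_vector \<times> real) set \<Rightarrow> ('a \<times> real) set \<Rightarrow> bool" where
  "represents S F \<longleftrightarrow>
     finite S \<and> S \<subseteq> F \<and>
     {x \<in> F. x extreme_point_of (convex hull F)} \<subseteq> S \<and>
     (\<forall>f :: 'a \<times> real \<Rightarrow> real.
        (\<forall>w. convex_on (convex hull {z. (w, z) \<in> F}) (\<lambda>z. f (w, z))) \<longrightarrow>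
        (\<exists>x y. is_arg_max f (\<lambda>p. p \<in> F) x \<and> is_arg_max f (\<lambda>p. p \<in> S) y \<and> f x = f y))"

end

theory Submission
  imports Defs
begin

text \<open>
  The state of a node records which labels are still available, so after \<open>k\<close> layers it is
  \<open>{0..m}\<close> minus the nonzero labels used so far, and the \<open>r\<close>-\<open>t\<close> paths spell exactly the vectors
  in which no nonzero label is repeated, followed by \<open>\<Gamma>\<close> or \<open>-\<Gamma>\<close>. The matching
  constraints say the same of \<open>w\<close>: all but at most one entry differ from a given \<open>j\<close>. Hence
  \<open>F = W \<times> {-\<Gamma>..\<Gamma>}\<close> and \<open>Sol D = W \<times> {\<Gamma>, -\<Gamma>}\<close> for the same finite \<open>W\<close>, and a function convex
  in \<open>z\<close> attains its maximum over an interval at an endpoint.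
\<close>

section \<open>Representing a bundle of intervals by their endpoints\<close>

lemma represents_Times_endpoints:
  fixes W :: "'a::real_vector set" and b :: real
  assumes "finite W" "W \<noteq> {}" "b \<ge> 0"
  shows "represents (W \<times> {b, -b}) (W \<times> {-b..b})"
  unfolding represents_def
proof (intro conjI allI impI)
  let ?S = "W \<times> {b, -b}" and ?F = "W \<times> {-b..b}"
  show fin: "finite ?S" using assms by simp
  show sub: "?S \<subseteq> ?F" using assms by auto
  show "{x \<in> ?F. x extreme_point_of (convex hull ?F)} \<subseteq> ?S"
  proof (intro subrelI)
    fix w z
    assume "(w, z) \<in> {x \<in> ?F. x extreme_point_of (convex hull ?F)}"
    then have w: "w \<in> W" and z: "- b \<le> z" "z \<le> b"
      and ext: "(w, z) extreme_point_of (convex hull ?F)" by auto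
    show "(w, z) \<in> ?S"
    proof (rule ccontr)
      assume "(w, z) \<notin> ?S"
      with w z have lt: "-b < z" "z < b" by auto
      have ends: "(w, -b) \<in> convex hull ?F" "(w, b) \<in> convex hull ?F"
        using w assms by (auto intro!: hull_inc)
      \<comment> \<open>\<open>u\<close> solves \<open>(1 - u) * (-b) + u * b = z\<close>. The
        strict bounds on \<open>z\<close> force \<open>b > 0\<close>, so the quotient is meaningful
        and lies strictly between 0 and 1.\<close>
      define u where "u = (z + b) / (2 * b)"
      have u: "0 < u" "u < 1" "(1 - u) * (-b) + u * b = z"
        using lt by (auto simp: u_def field_simps)
      have "(w, z) = (1 - u) *\<^sub>R (w, -b) + u *\<^sub>R (w, b)"
        using u(3) by (simp add: algebra_simps)
      moreover have "(w, -b) \<noteq> (w, b)" using lt by auto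
      ultimately have "(w, z) \<in> open_segment (w, -b) (w, b)"
        unfolding in_segment(2) using u(1,2) by blast
      with ext ends show False by (auto simp: extreme_point_of_def)
    qed
  qed
  fix f :: "'a \<times> real \<Rightarrow> real"
  assume f: "\<forall>w. convex_on (convex hull {z. (w, z) \<in> ?F}) (\<lambda>z. f (w, z))"
  have conv: "convex_on {-b..b} (\<lambda>z. f (w, z))" if "w \<in> W" for w
  proof -
    have slice: "{z. (w, z) \<in> ?F} = {-b..b}" using that by auto
    have "convex hull {z. (w, z) \<in> ?F} = {-b..b}"
      unfolding slice by (intro hull_same convex_real_interval)
    with spec[OF f, of w] show ?thesis by (simp only:)
  qed
  \<comment> \<open>A maximiser \<open>y\<close> over the finite set of endpoints is the witness for
    both maxima: on each fibre the values are bounded by those at its two ends.\<close>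
  have "?S \<noteq> {}" using assms by auto
  with fin have "Max (f ` ?S) \<in> f ` ?S" by (intro Max_in) auto
  then obtain y where y: "y \<in> ?S" and y_Max: "Max (f ` ?S) = f y" by (rule imageE)
  have y_max: "f x \<le> f y" if "x \<in> ?S" for x
    unfolding y_Max[symmetric] by (rule Max_ge[OF finite_imageI[OF fin] imageI[OF that]])
  have F_max: "f p \<le> f y" if "p \<in> ?F" for p
  proof -
    from that obtain w z where p: "p = (w, z)" and w: "w \<in> W" and z: "z \<in> {-b..b}"
      by (rule SigmaE)
    have "f (w, z) \<le> max (f (w, -b)) (f (w, b))"
      using convex_on_le_max[OF conv[OF w] z] by simp
    also have "\<dots> \<le> f y" using y_max[of "(w, -b)"] y_max[of "(w, b)"] w by simp
    finally show ?thesis by (simp only: p)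
  qed
  have "is_arg_max f (\<lambda>p. p \<in> ?F) y" "is_arg_max f (\<lambda>p. p \<in> ?S) y"
    unfolding is_arg_max_def using y y_max F_max sub by (meson leD subsetD)+
  then show "\<exists>x y. is_arg_max f (\<lambda>p. p \<in> ?F) x \<and> is_arg_max f (\<lambda>p. p \<in> ?S) y \<and> f x = f y"
    by blast
qed

section \<open>Partial matchings\<close>

text \<open>Entry \<open>c >= 1\<close> matches an incoming arc with the outgoing arc of index
  \<open>c\<close>; entry 0 leaves it unmatched, so only 0 may repeat.\<close>

definition partial_matching :: "nat \<Rightarrow> nat list \<Rightarrow> bool" where
  "partial_matching m ls \<longleftrightarrow> set ls \<subseteq> {0..m} \<and> (\<forall>c\<in>{1..m}. count_list ls c \<le> 1)"

text \<open>The leading 0 is the index shift of \<open>point_of_labels\<close>, so that the region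
  and the diagram can be compared with the same set.\<close>

definition matching_vectors :: "nat \<Rightarrow> nat \<Rightarrow> (nat, real) poly_mapping set" where
  "matching_vectors m n =
     (\<lambda>ls. Poly_Mapping.nth (0 # map real ls)) ` {ls. length ls = n \<and> partial_matching m ls}"

lemma partial_matching_Nil [simp]: "partial_matching m []"
  by (simp add: partial_matching_def)

text \<open>The set of admissible \<open>l\<close> is exactly the state of a diagram node reached by
  the labels \<open>ls\<close>. This ties extending a matching to following one more arc.\<close>

lemma partial_matching_snoc:
  "partial_matching m (ls @ [l]) \<longleftrightarrow>
     partial_matching m ls \<and> l \<in> {0..m} - (set ls - {0})"
proof
  assume *: "partial_matching m (ls @ [l])"
  then have le: "set (ls @ [l]) \<subseteq> {0..m}" "\<forall>c\<in>{1..m}. count_list (ls @ [l]) c \<le> 1"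
    unfolding partial_matching_def by blast+
  then have "count_list ls c \<le> 1" if "c \<in> {1..m}" for c
    using that by (metis count_list_append le_add1 order_trans)
  moreover have "l = 0 \<or> l \<notin> set ls"
  proof (cases "l = 0")
    case False
    with le(1) have "l \<in> {1..m}" by auto
    with le(2) have "count_list (ls @ [l]) l \<le> 1" by blast
    then have "count_list ls l = 0" by simp
    then show ?thesis by (simp add: count_list_0_iff)
  qed simp
  ultimately show "partial_matching m ls \<and> l \<in> {0..m} - (set ls - {0})"
    using * by (auto simp: partial_matching_def)
qed (auto simp: partial_matching_def)

lemma finite_matching_vectors: "finite (matching_vectors m n)"
proof -
  have "{ls. length ls = n \<and> partial_matching m ls} \<subseteq> {ls. set ls \<subseteq> {0..m} \<and> length ls = n}"
    by (auto simp: partial_matching_def)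
  then show ?thesis
    unfolding matching_vectors_def
    using finite_lists_length_eq[of "{0..m}" n] finite_subset by blast
qed

lemma matching_vectors_nonempty: "matching_vectors m n \<noteq> {}"
proof -
  have "partial_matching m (replicate n 0)"
    by (auto simp: partial_matching_def count_list_eq_length_filter)
  then show ?thesis unfolding matching_vectors_def by (auto intro!: exI[of _ "replicate n 0"])
qed

text \<open>Each summand is 0 where the entry equals \<open>c\<close> and 1 elsewhere. A lower bound
  of length minus one therefore says that \<open>c\<close> occurs at most once.\<close>

lemma sum_sgn_diff_eq:
  "(\<Sum>k<length ls. sgn \<bar>real (ls ! k) - real c\<bar>) = real (length ls) - real (count_list ls c)"
proof (induction ls rule: rev_induct)
  case (snoc l ls)
  have "(\<Sum>k<length ls. sgn \<bar>real ((ls @ [l]) ! k) - real c\<bar>)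
      = (\<Sum>k<length ls. sgn \<bar>real (ls ! k) - real c\<bar>)"
    by (intro sum.cong) (auto simp: nth_append)
  with snoc show ?case by (auto simp: sgn_if)
qed simp

section \<open>Coordinate vectors of lists and the product form of the master region\<close>

lemma keys_nth_zero_Cons: "Poly_Mapping.keys (Poly_Mapping.nth (0 # xs)) \<subseteq> {1..length xs}"
proof
  fix k assume "k \<in> Poly_Mapping.keys (Poly_Mapping.nth (0 # xs))"
  then have "nth_default 0 (0 # xs) k \<noteq> 0" by (metis in_keys_iff lookup_nth)
  then show "k \<in> {1..length xs}"
    by (cases k) (auto simp: nth_default_def split: if_splits)
qed

text \<open>Outside \<open>{1..length xs}\<close> both sides vanish: at 0 because of the prepended
  entry, beyond the length because of the default value of \<open>nth_default\<close>.\<close>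

lemma poly_mapping_eq_nth_zero_Cons:
  assumes "Poly_Mapping.keys w \<subseteq> {1..length xs}"
    and "\<And>k. k < length xs \<Longrightarrow> Poly_Mapping.lookup w (Suc k) = xs ! k"
  shows "w = Poly_Mapping.nth (0 # xs)"
proof (rule poly_mapping_eqI)
  fix k
  show "Poly_Mapping.lookup w k = Poly_Mapping.lookup (Poly_Mapping.nth (0 # xs)) k"
  proof (cases k)
    case 0
    have "0 \<notin> Poly_Mapping.keys w" using assms(1) by auto
    with 0 show ?thesis by (simp add: in_keys_iff)
  next
    case (Suc j)
    show ?thesis
    proof (cases "j < length xs")
      case False
      then have "k \<notin> Poly_Mapping.keys w" using assms(1) Suc by auto
      with False Suc show ?thesis by (simp add: in_keys_iff nth_default_def)
    qed (use assms(2) Suc in \<open>simp add: nth_default_def\<close>)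
  qed
qed

text \<open>The index bijections turn sums and quantifiers over neighbours into ones over indices;
  the sign constraints then bound multiplicities by \<open>sum_sgn_diff_eq\<close>.\<close>

lemma master_region_eq:
  assumes bin: "bij_betw (\<lambda>i. ind_in i q) (in_nbrs G q) {1..card (in_nbrs G q)}"
    and bout: "bij_betw (\<lambda>j. ind_out q j) (out_nbrs G q) {1..card (out_nbrs G q)}"
  shows "master_region G ind_in ind_out q b =
    matching_vectors (card (out_nbrs G q)) (card (in_nbrs G q)) \<times> {-b..b}"
proof -
  define n where "n = card (in_nbrs G q)"
  define m where "m = card (out_nbrs G q)"
  \<comment> \<open>The indices \<open>{1..n}\<close> are written as \<open>Suc k\<close> with
    \<open>k < n\<close> to agree with zero-based list positions.\<close>
  have image_in: "(\<lambda>i. ind_in i q) ` in_nbrs G q = Suc ` {..<n}"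
    using bin by (simp add: n_def bij_betw_def image_Suc_lessThan)
  have sum_in: "(\<Sum>i\<in>in_nbrs G q. g (ind_in i q)) = (\<Sum>k<n. g (Suc k))" for g :: "nat \<Rightarrow> real"
  proof -
    have "(\<Sum>i\<in>in_nbrs G q. g (ind_in i q)) = (\<Sum>h\<in>Suc ` {..<n}. g h)"
      using sum.reindex_bij_betw[OF bin, of g] by (simp add: n_def image_Suc_lessThan)
    then show ?thesis by (simp add: sum.reindex)
  qed
  have all_in: "(\<forall>i\<in>in_nbrs G q. P (ind_in i q)) \<longleftrightarrow> (\<forall>k<n. P (Suc k))" for P
    using arg_cong[OF image_in, of "\<lambda>A. \<forall>h\<in>A. P h"] by auto
  have all_out: "(\<forall>j\<in>out_nbrs G q. P (ind_out q j)) \<longleftrightarrow> (\<forall>c\<in>{1..m}. P c)" for P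
    using arg_cong[of _ _ "\<lambda>A. \<forall>h\<in>A. P h", OF bij_betw_imp_surj_on[OF bout]]
    by (simp add: m_def)
  let ?feas = "\<lambda>w. Poly_Mapping.keys w \<subseteq> {1..n} \<and>
    (\<forall>c\<in>{1..m}. (\<Sum>k<n. sgn \<bar>Poly_Mapping.lookup w (Suc k) - real c\<bar>) \<ge> real n - 1) \<and>
    (\<forall>k<n. Poly_Mapping.lookup w (Suc k) \<in> real ` {0..m})"
  have region: "(w, z) \<in> master_region G ind_in ind_out q b \<longleftrightarrow> ?feas w \<and> z \<in> {-b..b}" for w z
    unfolding master_region_def
    using all_out[of "\<lambda>c. (\<Sum>k<n. sgn \<bar>Poly_Mapping.lookup w (Suc k) - real c\<bar>) \<ge> real n - 1"]
      all_in[of "\<lambda>h. Poly_Mapping.lookup w h \<in> real ` {0..m}"]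
      sum_in[of "\<lambda>h. sgn \<bar>Poly_Mapping.lookup w h - real c\<bar>" for c]
    by (simp add: n_def m_def)
  have feas_nth: "?feas (Poly_Mapping.nth (0 # map real ls)) \<longleftrightarrow> partial_matching m ls"
    if len: "length ls = n" for ls
  proof -
    have lookup: "Poly_Mapping.lookup (Poly_Mapping.nth (0 # map real ls)) (Suc k) = real (ls ! k)"
      if "k < n" for k using that len by (simp add: nth_default_def)
    have "(\<Sum>k<n. sgn \<bar>Poly_Mapping.lookup (Poly_Mapping.nth (0 # map real ls)) (Suc k) - real c\<bar>)
        = real n - real (count_list ls c)" for c
      using sum_sgn_diff_eq[of ls c] len lookup by simp
    moreover have "Poly_Mapping.keys (Poly_Mapping.nth (0 # map real ls)) \<subseteq> {1..n}"
      using keys_nth_zero_Cons[of "map real ls"] len by simp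
    moreover have "(\<forall>k<n. real (ls ! k) \<in> real ` {0..m}) \<longleftrightarrow> set ls \<subseteq> {0..m}"
      using len by (fastforce simp: set_conv_nth image_iff)
    ultimately show ?thesis
      using lookup unfolding partial_matching_def
      by (auto simp del: lookup_nth keys_nth)
  qed
  have feas_iff: "?feas w \<longleftrightarrow> w \<in> matching_vectors m n" for w
  proof
    assume feas: "?feas w"
    \<comment> \<open>Integrality gives a natural number for each coordinate; choice collects them
      into the list that encodes \<open>w\<close>.\<close>
    then have "\<forall>k. \<exists>a. k < n \<longrightarrow> Poly_Mapping.lookup w (Suc k) = real a" by blast
    from choice[OF this]
    obtain g where g: "\<And>k. k < n \<Longrightarrow> Poly_Mapping.lookup w (Suc k) = real (g k)"
      by (elim exE) (rule that, simp)
    define ls where "ls = map g [0..<n]"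
    have "w = Poly_Mapping.nth (0 # map real ls)"
      using feas g by (intro poly_mapping_eq_nth_zero_Cons) (auto simp: ls_def)
    moreover have "length ls = n" by (simp add: ls_def)
    ultimately show "w \<in> matching_vectors m n"
      using feas feas_nth[of ls] by (auto simp: matching_vectors_def)
  next
    assume "w \<in> matching_vectors m n"
    then show "?feas w" using feas_nth unfolding matching_vectors_def by blast
  qed
  show ?thesis
    unfolding n_def[symmetric] m_def[symmetric]
    by (intro equalityI subrelI) (simp_all only: region feas_iff mem_Sigma_iff)
qed

section \<open>Paths in layered diagrams\<close>

locale layered_diagram =
  fixes N :: nat and D :: "('u, 'e) diagram"
  assumes dd: "decision_diagram N D"

sublocale layered_diagram \<subseteq> fin_digraph "dgraph D"
  using dd by (simp add: decision_diagram_def)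

context layered_diagram
begin

abbreviation "rt \<equiv> root_node D"

lemma node_layers: "verts (dgraph D) = (\<Union>j\<in>{1..N + 1}. node_layer D j)"
    "disjoint_family_on (node_layer D) {1..N + 1}"
  and arc_layers: "arcs (dgraph D) = (\<Union>j\<in>{1..N}. arc_layer D j)"
  and root_layer: "node_layer D (Suc 0) = {rt}"
  and terminal_layer: "node_layer D (Suc N) = {terminal_node D}"
  and arc_ends: "\<forall>j\<in>{1..N}. \<forall>a\<in>arc_layer D j.
        tail (dgraph D) a \<in> node_layer D j \<and> head (dgraph D) a \<in> node_layer D (j + 1)"
  using dd by (simp_all add: decision_diagram_def)

lemma node_layer_unique:
  assumes "u \<in> node_layer D i" "u \<in> node_layer D j" "i \<in> {1..N + 1}" "j \<in> {1..N + 1}"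
  shows "i = j"
  using assms disjoint_family_onD[OF node_layers(2), of i j] by auto

lemma
  assumes "a \<in> arc_layer D j" "j \<in> {1..N}"
  shows arc_layer_in_arcs: "a \<in> arcs (dgraph D)"
    and tail_in_node_layer: "tail (dgraph D) a \<in> node_layer D j"
    and head_in_node_layer: "head (dgraph D) a \<in> node_layer D (j + 1)"
  using assms arc_layers arc_ends by auto

text \<open>The arc belongs to some layer, whose index is that of its tail's node layer, and node
  layers are disjoint. In particular no arc leaves layer \<open>N + 1\<close>.\<close>

lemma arc_in_layer_of_tail:
  assumes "a \<in> arcs (dgraph D)" "tail (dgraph D) a \<in> node_layer D i" "i \<in> {1..N + 1}"
  shows "i \<in> {1..N} \<and> a \<in> arc_layer D i"
proof -
  from assms(1) obtain j where j: "j \<in> {1..N}" "a \<in> arc_layer D j"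
    by (auto simp: arc_layers)
  then have "i = j"
    using tail_in_node_layer[OF j(2,1)] assms by (intro node_layer_unique[of "tail (dgraph D) a"]) auto
  with j show ?thesis by simp
qed

lemma root_in_verts: "rt \<in> verts (dgraph D)"
  using root_layer by (auto simp: node_layers(1) intro!: bexI[of _ "Suc 0"])

lemma awalk_snoc:
  "awalk u (p @ [a]) v \<longleftrightarrow>
     awalk u p (tail (dgraph D) a) \<and> a \<in> arcs (dgraph D) \<and> head (dgraph D) a = v"
  by (auto simp: awalk_simps)

text \<open>Every arc descends one layer, so the length determines the layer of the endpoint, and
  each new vertex lies below all earlier ones. The conjunct on visited layers is what carries
  distinctness through the induction.\<close>

lemma awalk_root:
  assumes "awalk rt p v"
  shows "length p \<le> N \<and> v \<in> node_layer D (Suc (length p)) \<and> distinct (awalk_verts rt p) \<and>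
    set (awalk_verts rt p) \<subseteq> (\<Union>j\<in>{1..Suc (length p)}. node_layer D j)"
  using assms
proof (induction p arbitrary: v rule: rev_induct)
  case Nil
  then show ?case by (auto simp: awalk_Nil_iff root_layer)
next
  case (snoc a p)
  let ?k = "Suc (length p)"
  from snoc.prems have p: "awalk rt p (tail (dgraph D) a)" and a: "a \<in> arcs (dgraph D)"
    and v: "head (dgraph D) a = v" by (auto simp: awalk_snoc)
  note IH = snoc.IH[OF p]
  have k: "?k \<in> {1..N}" "a \<in> arc_layer D ?k" using arc_in_layer_of_tail[OF a, of ?k] IH by auto
  then have v_layer: "v \<in> node_layer D (Suc ?k)"
    using head_in_node_layer[of a ?k] v by simp
  have "v \<notin> node_layer D j" if "j \<in> {1..?k}" for j
    using node_layer_unique[OF v_layer, of j] k that by auto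
  then have new: "v \<notin> set (awalk_verts rt p)" using IH by blast
  have verts: "awalk_verts rt (p @ [a]) = awalk_verts rt p @ [v]"
    using awalk_verts_append[OF snoc.prems] v by simp
  have "set (awalk_verts rt p) \<subseteq> (\<Union>j\<in>{1..Suc ?k}. node_layer D j)"
    using IH by fastforce
  moreover have "v \<in> (\<Union>j\<in>{1..Suc ?k}. node_layer D j)"
    using v_layer by (intro UN_I[of "Suc ?k"]) auto
  ultimately have "set (awalk_verts rt (p @ [a])) \<subseteq> (\<Union>j\<in>{1..Suc ?k}. node_layer D j)"
    by (simp add: verts)
  moreover have "distinct (awalk_verts rt (p @ [a]))" using IH new by (simp add: verts)
  moreover have "length (p @ [a]) = ?k" by simp
  ultimately show ?case using k(1) v_layer by (metis atLeastAtMost_iff)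
qed

text \<open>Walks from the root are automatically vertex-simple, and the layer of the terminal fixes
  their length.\<close>

lemma apath_root_terminal_iff:
  "apath rt p (terminal_node D) \<longleftrightarrow> length p = N \<and> awalk rt p (terminal_node D)"
proof -
  have "length p = N" if "awalk rt p (terminal_node D)"
    using awalk_root[OF that] node_layer_unique[of "terminal_node D" "Suc (length p)" "Suc N"]
      terminal_layer by auto
  then show ?thesis using awalk_root unfolding apath_def by blast
qed

end

section \<open>The exact diagram\<close>

text \<open>The construction as a path sees it: \<open>arc_step\<close> and
  \<open>last_arc_label\<close> restrict the labels that can be read, \<open>arc_exists\<close> and
  \<open>last_arc_exists\<close> guarantee that every permitted label can be followed. The two pairs
  yield the two inclusions of \<open>Sol_eq\<close>.\<close>

locale exact_diagram = layered_diagram "Suc n" D for n and D :: "('u, 'e) diagram" +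
  fixes m :: nat and b :: real and st :: "'u \<Rightarrow> nat set"
  assumes root_state: "st (root_node D) = {0..m}"
    and arc_step: "\<lbrakk>i \<in> {1..n}; a \<in> arc_layer D i\<rbrakk> \<Longrightarrow>
      \<exists>l\<in>st (tail (dgraph D) a). arc_label D a = real l \<and>
        st (head (dgraph D) a) = (st (tail (dgraph D) a) - {l}) \<union> {0}"
    and arc_exists: "\<lbrakk>i \<in> {1..n}; u \<in> node_layer D i; l \<in> st u\<rbrakk> \<Longrightarrow>
      \<exists>a\<in>arc_layer D i. tail (dgraph D) a = u \<and> arc_label D a = real l"
    and last_arc_label: "a \<in> arc_layer D (Suc n) \<Longrightarrow> arc_label D a \<in> {b, -b}"
    and last_arc_exists: "\<lbrakk>u \<in> node_layer D (Suc n); z \<in> {b, -b}\<rbrakk> \<Longrightarrow>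
      \<exists>a\<in>arc_layer D (Suc n). tail (dgraph D) a = u \<and> arc_label D a = z"
begin

text \<open>The formula for the state is the invariant that makes the induction work: choosing a
  label from it is exactly the condition in \<open>partial_matching_snoc\<close>. The length bound
  keeps the walk out of the last arc layer, which carries \<open>z\<close>.\<close>

lemma awalk_root_labels:
  assumes "awalk rt p v" "length p \<le> n"
  shows "\<exists>ls. map (arc_label D) p = map real ls \<and> partial_matching m ls \<and>
    st v = {0..m} - (set ls - {0})"
  using assms
proof (induction p arbitrary: v rule: rev_induct)
  case Nil
  then show ?case by (auto simp: awalk_Nil_iff root_state)
next
  case (snoc a p)
  from snoc.prems have p: "awalk rt p (tail (dgraph D) a)" and a: "a \<in> arcs (dgraph D)"
    and v: "head (dgraph D) a = v" by (auto simp: awalk_snoc)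
  from snoc.IH[OF p] snoc.prems(2) obtain ls where
    ls: "map (arc_label D) p = map real ls" "partial_matching m ls"
      "st (tail (dgraph D) a) = {0..m} - (set ls - {0})" by auto
  have "a \<in> arc_layer D (Suc (length p))"
    using arc_in_layer_of_tail[OF a] awalk_root[OF p] by auto
  with arc_step[of "Suc (length p)" a] snoc.prems(2) obtain l where
    l: "l \<in> st (tail (dgraph D) a)" "arc_label D a = real l"
      "st v = (st (tail (dgraph D) a) - {l}) \<union> {0}"
    using v by auto
  \<comment> \<open>Restoring 0 after deleting \<open>l\<close> matches the removal of nonzero
    labels only, also when \<open>l\<close> itself is 0.\<close>
  have "st v = {0..m} - (set (ls @ [l]) - {0})"
    unfolding l(3) ls(3) by auto
  moreover have "partial_matching m (ls @ [l])"
    using ls(2,3) l(1) by (simp only: partial_matching_snoc)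
  moreover have "map (arc_label D) (p @ [a]) = map real (ls @ [l])"
    using ls(1) l(2) by simp
  ultimately show ?case by blast
qed

text \<open>The walk is grown label by label. The next label is in the state of the current endpoint
  by \<open>awalk_root_labels\<close>, so an arc carrying it exists.\<close>

lemma awalk_root_of_labels:
  assumes "partial_matching m ls" "length ls \<le> n"
  shows "\<exists>p v. awalk rt p v \<and> map (arc_label D) p = map real ls"
  using assms
proof (induction ls rule: rev_induct)
  case Nil
  then show ?case using root_in_verts by (auto simp: awalk_Nil_iff)
next
  case (snoc l ls)
  then obtain p u where p: "awalk rt p u" "map (arc_label D) p = map real ls"
    by (auto simp: partial_matching_snoc)
  have len: "length p = length ls" using p(2) by (metis length_map)
  \<comment> \<open>The list supplied by \<open>awalk_root_labels\<close> is only known to have the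
    same real labels; injectivity of \<open>real\<close> identifies it with
    \<open>ls\<close>.\<close>
  from awalk_root_labels[OF p(1)] p(2) have "st u = {0..m} - (set ls - {0})"
    using len snoc.prems(2) inj_map_eq_map[OF inj_of_nat, where 'a1 = real] by auto
  then have "l \<in> st u" using snoc.prems(1) by (simp add: partial_matching_snoc)
  with arc_exists[of "Suc (length p)" u l] awalk_root[OF p(1)] len snoc.prems(2)
  obtain a where a: "a \<in> arc_layer D (Suc (length p))" "tail (dgraph D) a = u"
      "arc_label D a = real l" by auto
  then have "awalk rt (p @ [a]) (head (dgraph D) a)"
    unfolding awalk_snoc using p(1) arc_layer_in_arcs[OF a(1)] a(2) len snoc.prems(2) by simp
  with p(2) a(3) show ?case by (intro exI[of _ "p @ [a]"]) auto
qed

text \<open>Splitting off the last arc separates the coordinates: the first \<open>n\<close> arcs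
  spell a partial matching, the last one gives \<open>z\<close>.\<close>

lemma Sol_eq: "Sol D = matching_vectors m n \<times> {b, -b}"
proof (intro set_eqI iffI)
  fix x assume "x \<in> Sol D"
  then obtain p where "awalk rt p (terminal_node D)" "length p = Suc n"
    and x: "x = point_of_labels (map (arc_label D) p)"
    by (auto simp: Sol_def apath_root_terminal_iff)
  then obtain p' a where p: "p = p' @ [a]" "length p' = n" "awalk rt p' (tail (dgraph D) a)"
      "a \<in> arcs (dgraph D)"
    by (cases p rule: rev_cases) (auto simp: awalk_snoc)
  obtain ls where ls: "map (arc_label D) p' = map real ls" "partial_matching m ls"
    using awalk_root_labels[OF p(3)] p(2) by auto
  have "a \<in> arc_layer D (Suc n)"
    using arc_in_layer_of_tail[OF p(4)] awalk_root[OF p(3)] p(2) by auto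
  then have "arc_label D a \<in> {b, -b}" by (rule last_arc_label)
  moreover have "length ls = n" using ls(1) p(2) by (metis length_map)
  ultimately show "x \<in> matching_vectors m n \<times> {b, -b}"
    using ls x p(1) by (auto simp: point_of_labels_def matching_vectors_def butlast_append)
next
  fix x assume "x \<in> matching_vectors m n \<times> {b, -b}"
  then obtain ls z where ls: "length ls = n" "partial_matching m ls"
    and z: "z \<in> {b, -b}" and x: "x = (Poly_Mapping.nth (0 # map real ls), z)"
    by (auto simp: matching_vectors_def)
  from awalk_root_of_labels[OF ls(2)] ls(1) obtain p u where
    p: "awalk rt p u" "map (arc_label D) p = map real ls" by auto
  have len: "length p = n" using p(2) ls(1) by (metis length_map)
  from last_arc_exists[OF _ z] awalk_root[OF p(1)] len obtain a where
    a: "a \<in> arc_layer D (Suc n)" "tail (dgraph D) a = u" "arc_label D a = z" by auto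
  \<comment> \<open>The node layer after the last arc layer is a singleton, so any such arc
    completes the path.\<close>
  have "head (dgraph D) a = terminal_node D"
    using head_in_node_layer[OF a(1)] terminal_layer by auto
  then have "awalk rt (p @ [a]) (terminal_node D)"
    unfolding awalk_snoc using p(1) a(2) arc_layer_in_arcs[OF a(1)] by simp
  then have "apath rt (p @ [a]) (terminal_node D)"
    using len by (simp add: apath_root_terminal_iff)
  moreover have "x = point_of_labels (map (arc_label D) (p @ [a]))"
    using x p(2) a(3) by (simp add: point_of_labels_def butlast_append)
  ultimately show "x \<in> Sol D" unfolding Sol_def by blast
qed

end

text \<open>Surjectivity of \<open>e\<close> onto an arc layer says that every arc there was created
  from some node and label, giving \<open>arc_step\<close>; that \<open>e\<close> maps into the
  layer gives \<open>arc_exists\<close>.\<close>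

lemma exact_construction_imp_exact_diagram:
  assumes "exact_construction G q b D"
  shows "\<exists>st. exact_diagram (card (in_nbrs G q)) D (card (out_nbrs G q)) b st"
proof -
  define n where "n = card (in_nbrs G q)"
  define m where "m = card (out_nbrs G q)"
  note construction =
    assms[unfolded exact_construction_def Let_def, folded n_def m_def Suc_eq_plus1]
  from construction have dd: "decision_diagram (Suc n) D" by (rule conjunct1)
  from construction obtain st where root: "st (root_node D) = {0..m}"
    and step: "\<forall>i\<in>{1..n}. \<exists>v e.
          bij_betw v (SIGMA u:node_layer D i. st u) (node_layer D (Suc i)) \<and>
          bij_betw e (SIGMA u:node_layer D i. st u) (arc_layer D i) \<and>
          (\<forall>u\<in>node_layer D i. \<forall>l\<in>st u.
             st (v (u, l)) = (st u - {l}) \<union> {0} \<and>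
             tail (dgraph D) (e (u, l)) = u \<and>
             head (dgraph D) (e (u, l)) = v (u, l) \<and>
             arc_label D (e (u, l)) = real l)"
    and last: "\<exists>a\<^sub>1 a\<^sub>2.
          arc_layer D (Suc n) = a\<^sub>1 ` node_layer D (Suc n) \<union> a\<^sub>2 ` node_layer D (Suc n) \<and>
          (\<forall>u\<in>node_layer D (Suc n).
             a\<^sub>1 u \<noteq> a\<^sub>2 u \<and>
             tail (dgraph D) (a\<^sub>1 u) = u \<and> tail (dgraph D) (a\<^sub>2 u) = u \<and>
             head (dgraph D) (a\<^sub>1 u) = terminal_node D \<and> head (dgraph D) (a\<^sub>2 u) = terminal_node D \<and>
             arc_label D (a\<^sub>1 u) = b \<and> arc_label D (a\<^sub>2 u) = -b)"
    by (rule exE[OF conjunct2]) (elim conjE, rule that)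
  have "exact_diagram n D m b st"
  proof
    show "decision_diagram (Suc n) D" "st (root_node D) = {0..m}" by fact+
  next
    fix i a assume i: "i \<in> {1..n}" and a: "a \<in> arc_layer D i"
    from bspec[OF step i] obtain v e
      where bij: "bij_betw e (SIGMA u:node_layer D i. st u) (arc_layer D i)"
      and ve: "\<forall>u\<in>node_layer D i. \<forall>l\<in>st u.
             st (v (u, l)) = (st u - {l}) \<union> {0} \<and>
             tail (dgraph D) (e (u, l)) = u \<and>
             head (dgraph D) (e (u, l)) = v (u, l) \<and>
             arc_label D (e (u, l)) = real l"
      by (elim exE conjE) (rule that)
    from a have "a \<in> e ` (SIGMA u:node_layer D i. st u)"
      by (simp only: bij_betw_imp_surj_on[OF bij])
    then obtain u l where "u \<in> node_layer D i" "l \<in> st u" "a = e (u, l)" by blast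
    with ve show "\<exists>l\<in>st (tail (dgraph D) a). arc_label D a = real l \<and>
        st (head (dgraph D) a) = (st (tail (dgraph D) a) - {l}) \<union> {0}"
      by (intro bexI[of _ l]) simp_all
  next
    fix i u l assume i: "i \<in> {1..n}" and ul: "u \<in> node_layer D i" "l \<in> st u"
    from bspec[OF step i] obtain v e
      where bij: "bij_betw e (SIGMA u:node_layer D i. st u) (arc_layer D i)"
      and ve: "\<forall>u\<in>node_layer D i. \<forall>l\<in>st u.
             st (v (u, l)) = (st u - {l}) \<union> {0} \<and>
             tail (dgraph D) (e (u, l)) = u \<and>
             head (dgraph D) (e (u, l)) = v (u, l) \<and>
             arc_label D (e (u, l)) = real l"
      by (elim exE conjE) (rule that)
    have "e (u, l) \<in> arc_layer D i"
      using bij_betwE[OF bij] ul by simp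
    with ve ul show "\<exists>a\<in>arc_layer D i. tail (dgraph D) a = u \<and> arc_label D a = real l"
      by (intro bexI[of _ "e (u, l)"]) simp_all
  next
    fix a assume "a \<in> arc_layer D (Suc n)"
    with last show "arc_label D a \<in> {b, -b}" by auto
  next
    fix u z assume "u \<in> node_layer D (Suc n)" "z \<in> {b, -b}"
    with last show "\<exists>a\<in>arc_layer D (Suc n). tail (dgraph D) a = u \<and> arc_label D a = z"
      by (metis UnI1 UnI2 empty_iff imageI insert_iff)
  qed
  then show ?thesis unfolding n_def m_def by blast
qed

theorem theorem1:
  fixes G :: "'v pair_pre_digraph" and V' :: "'v set" and s t q :: 'v and Vbar :: "'v set"
    and ind_in ind_out :: "'v \<Rightarrow> 'v \<Rightarrow> nat" and \<Gamma> :: real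
    and D :: "('u, 'e) diagram"
  assumes "gufp_network G V' s t Vbar ind_in ind_out"
    and "Vbar = {q}"
    and "\<Gamma> \<ge> 0"
    and "exact_construction G q \<Gamma> D"
  shows "represents (Sol D) (master_region G ind_in ind_out q \<Gamma>)"
proof -
  interpret gufp_network G V' s t Vbar ind_in ind_out by fact
  obtain st where "exact_diagram (card (in_nbrs G q)) D (card (out_nbrs G q)) \<Gamma> st"
    using exact_construction_imp_exact_diagram[OF assms(4)] by blast
  then have "Sol D = matching_vectors (card (out_nbrs G q)) (card (in_nbrs G q)) \<times> {\<Gamma>, -\<Gamma>}"
    by (rule exact_diagram.Sol_eq)
  moreover have "master_region G ind_in ind_out q \<Gamma> =
      matching_vectors (card (out_nbrs G q)) (card (in_nbrs G q)) \<times> {-\<Gamma>..\<Gamma>}"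
    using ind_in_bij ind_out_bij assms(2) by (intro master_region_eq) auto
  ultimately show ?thesis
    using represents_Times_endpoints finite_matching_vectors matching_vectors_nonempty assms(3)
    by metis
qed

end
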